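(* Let $f:\mathbb R\to\mathbb R$ be continuous with $f(u_2)-f(u_1)\le\kappa(u_2-u_1)$ for all $u_1<u_2$, for some $\kappa\in\mathbb R$. For every $T>0$ and $z\in C_b([0,T]\times\mathbb R^d)$ there exists $u\in C_b([0,T]\times\mathbb R^d)$ solving $$u(t,x)=\int_0^t\int_{\mathbb R^d}G(t-s,x-y)f(u(s,y))dyds+z(t,x),\quad (t,x)\in[0,T]\times\mathbb R^d.$$
   Context: $G(t,x)=(2\pi t)^{-d/2}e^{-|x|^2/(2t)}$; $C_b([0,T]\times\mathbb R^d)$ is the space of bounded continuous real functions on $[0,T]\times\mathbb R^d$. *)

theory Defs
  imports "HOL-Analysis.Analysis"
begin

definition heat_kernel :: "real \<Rightarrow> 'a::euclidean_space \<Rightarrow> real" where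
  "heat_kernel t x = (2 * pi * t) powr (- real DIM('a) / 2) * exp (- (norm x)\<^sup>2 / (2 * t))"

definition Cb :: "real \<Rightarrow> (real \<times> 'a::euclidean_space \<Rightarrow> real) set" where
  "Cb T = {u. continuous_on ({0..T} \<times> UNIV) u \<and> bounded (u ` ({0..T} \<times> UNIV))}"

end

theory Submission
  imports Defs "HOL-Probability.Distributions"
begin

text \<open>
  Let \<open>R\<^sub>a h\<close> be the convolution of \<open>1\<^bsub>t \<ge> 0\<^esub> h\<close> with the damped heat kernel \<open>exp (- a t) G(t, x)\<close>, an operator
  of norm at most \<open>1 / a\<close> on bounded continuous functions on space-time. The semigroup property of
  \<open>G\<close> gives the resolvent identity \<open>R\<^sub>a - R\<^sub>b = (b - a) R\<^sub>a R\<^sub>b\<close>, hence \<open>w = R\<^sub>a h\<close> if and only if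
  \<open>w = R\<^bsub>l + a\<^esub> (h + l w)\<close>. We may assume \<open>\<kappa> \<ge> 0\<close>; put \<open>\<mu> = \<kappa> + 1\<close>, so that \<open>w = exp (- \<mu> t) (u - z)\<close> has to
  solve \<open>w = R\<^sub>\<mu> (exp (- \<mu> t) f(exp (\<mu> t) w + z))\<close>.

  If \<open>f\<close> is Lipschitz with constant \<open>l\<close>, the shift by \<open>l w\<close> makes the nonlinearity \<open>(\<kappa> + l)\<close>-Lipschitz, so
  the right-hand side of the shifted equation is a contraction with factor \<open>(\<kappa> + l) / (\<mu> + l)\<close>. The
  same computation yields estimates that do not depend on \<open>l\<close>: solutions for two nonlinearities differ
  by at most the sup distance of the nonlinearities, and \<open>w\<close> is bounded by \<open>sup |f(z)|\<close>. Because of the latter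
  bound \<open>f\<close> may be truncated outside a large interval; the truncation is uniformly continuous, hence a
  uniform limit of Lipschitz functions with the same one-sided constant, and by the former bound the
  corresponding solutions form a Cauchy sequence.
\<close>

section \<open>The heat kernel\<close>

lemma lborel_distr_reflect:
  fixes p :: "'a::euclidean_space"
  shows "distr lborel borel (\<lambda>q. p - q) = lborel"
  by (subst lborel_affine[of "-1" p]) (auto simp: density_1 one_ennreal_def[symmetric])

lemma nn_integral_lborel_reflect:
  fixes p :: "'a::euclidean_space"
  assumes [measurable]: "f \<in> borel_measurable borel"
  shows "(\<integral>\<^sup>+q. f (p - q) \<partial>lborel) = (\<integral>\<^sup>+q. f q \<partial>lborel)"
  by (subst lborel_distr_reflect[of p, symmetric], subst nn_integral_distr) auto

lemma integral_lborel_reflect: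
  fixes p :: "'a::euclidean_space" and f :: "'a \<Rightarrow> real"
  assumes [measurable]: "f \<in> borel_measurable borel"
  shows "(\<integral>q. f (p - q) \<partial>lborel) = (\<integral>q. f q \<partial>lborel)"
  by (subst (2) lborel_distr_reflect[of p, symmetric], subst integral_distr) auto

lemma integrable_lborel_reflect:
  fixes p :: "'a::euclidean_space" and f :: "'a \<Rightarrow> real"
  assumes [measurable]: "f \<in> borel_measurable borel"
  shows "integrable lborel (\<lambda>q. f (p - q)) \<longleftrightarrow> integrable lborel f"
  by (subst (2) lborel_distr_reflect[of p, symmetric], subst integrable_distr_eq) auto

lemma heat_kernel_nonneg [simp]: "0 \<le> heat_kernel t x"
  by (simp add: heat_kernel_def)

lemma measurable_heat_kernel [measurable]:
  assumes [measurable]: "f \<in> borel_measurable M" "g \<in> borel_measurable M"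
  shows "(\<lambda>q. heat_kernel (f q) (g q :: 'a::euclidean_space)) \<in> borel_measurable M"
  unfolding heat_kernel_def by measurable

text \<open>The coordinates decouple, each with variance \<open>t\<close>, so the total mass reduces
  to that of a one-dimensional normal density.\<close>

lemma heat_kernel_eq_prod_normal_density:
  fixes x :: "'a::euclidean_space"
  assumes "t > 0"
  shows "heat_kernel t x = (\<Prod>b\<in>Basis. normal_density 0 (sqrt t) (x \<bullet> b))"
proof -
  have "(2 * pi * t) powr (- real DIM('a) / 2) = (1 / sqrt (2 * pi * t)) ^ DIM('a)"
  proof -
    have "1 / sqrt (2 * pi * t) = (2 * pi * t) powr (- 1 / 2)"
      using assms by (simp add: powr_half_sqrt[symmetric] powr_minus_divide)
    then show ?thesis
      using assms by (simp add: powr_power)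
  qed
  moreover have "(norm x)\<^sup>2 = (\<Sum>b\<in>Basis. (x \<bullet> b)\<^sup>2)"
    unfolding power2_norm_eq_inner by (subst euclidean_inner) (simp add: power2_eq_square)
  then have "exp (- (norm x)\<^sup>2 / (2 * t)) = (\<Prod>b\<in>Basis. exp (- (x \<bullet> b)\<^sup>2 / (2 * t)))"
    by (simp add: exp_sum[symmetric] sum_negf sum_divide_distrib)
  ultimately show ?thesis
    using assms by (simp add: heat_kernel_def normal_density_def prod.distrib[symmetric] prod_dividef power_divide)
qed

lemma nn_integral_heat_kernel:
  assumes "t > 0"
  shows "(\<integral>\<^sup>+x. heat_kernel t (x::'a::euclidean_space) \<partial>lborel) = 1"
proof -
  have "(\<integral>\<^sup>+x. heat_kernel t (x::'a) \<partial>lborel)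
      = (\<integral>\<^sup>+(x::'a). (\<Prod>b\<in>Basis. ennreal (normal_density 0 (sqrt t) (x \<bullet> b))) \<partial>lborel)"
    using assms by (simp add: heat_kernel_eq_prod_normal_density prod_ennreal)
  also have "\<dots> = (\<Prod>b\<in>(Basis::'a set). (\<integral>\<^sup>+x. ennreal (normal_density 0 (sqrt t) x) \<partial>lborel))"
    by (rule nn_integral_lborel_prod) auto
  also have "\<dots> = 1"
    using assms by (simp add: nn_integral_eq_integral)
  finally show ?thesis .
qed

text \<open>Completing the square in \<open>y\<close>: the product is, as a function of
  \<open>y\<close>, a Gaussian of Brownian bridge type, with mean
  \<open>(s / (s + r)) *\<^sub>R x\<close> and variance \<open>s * r / (s + r)\<close>. The
  prefactors match because \<open>s * r\<close> is also the product of the two variances on the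
  right.\<close>

lemma heat_kernel_mult:
  fixes x y :: "'a::euclidean_space"
  assumes "s > 0" "r > 0"
  shows "heat_kernel s y * heat_kernel r (x - y)
       = heat_kernel (s + r) x * heat_kernel (s * r / (s + r)) (y - (s / (s + r)) *\<^sub>R x)"
proof -
  have sq: "(norm y)\<^sup>2 / s + (norm (x - y))\<^sup>2 / r
      = (norm x)\<^sup>2 / (s + r) + (norm (y - (s / (s + r)) *\<^sub>R x))\<^sup>2 / (s * r / (s + r))"
  proof -
    have "s + r > 0" using assms by simp
    then show ?thesis using assms
      unfolding power2_norm_eq_inner
      by (simp add: inner_diff_left inner_diff_right inner_commute[of y x] divide_simps)
        (simp add: algebra_simps)
  qed
  have halve: "- p / (2 * u) + - q / (2 * v) = - (p / u + q / v) / 2" for p q u v :: real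
    by (simp add: add_divide_distrib diff_divide_distrib mult.commute)
  have "- (norm y)\<^sup>2 / (2 * s) + - (norm (x - y))\<^sup>2 / (2 * r)
      = - ((norm y)\<^sup>2 / s + (norm (x - y))\<^sup>2 / r) / 2"
    by (rule halve)
  also have "\<dots> = - (norm x)\<^sup>2 / (2 * (s + r))
      + - (norm (y - (s / (s + r)) *\<^sub>R x))\<^sup>2 / (2 * (s * r / (s + r)))"
    unfolding sq by (rule halve[symmetric])
  finally have e: "exp (- (norm y)\<^sup>2 / (2 * s)) * exp (- (norm (x - y))\<^sup>2 / (2 * r))
      = exp (- (norm x)\<^sup>2 / (2 * (s + r)))
        * exp (- (norm (y - (s / (s + r)) *\<^sub>R x))\<^sup>2 / (2 * (s * r / (s + r))))"
    by (simp only: exp_add[symmetric])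
  have "(2 * pi * s) * (2 * pi * r) = (2 * pi * (s + r)) * (2 * pi * (s * r / (s + r)))"
    using assms by simp
  then have "((2 * pi * s) * (2 * pi * r)) powr a = ((2 * pi * (s + r)) * (2 * pi * (s * r / (s + r)))) powr a" for a
    by (rule arg_cong)
  then have p: "(2 * pi * s) powr a * (2 * pi * r) powr a
      = (2 * pi * (s + r)) powr a * (2 * pi * (s * r / (s + r))) powr a" for a
    using assms by (simp only: powr_mult)
  show ?thesis
    unfolding heat_kernel_def
    using arg_cong2[OF p[of "- real DIM('a) / 2"] e, of "(*)"] by (simp only: mult_ac)
qed

text \<open>By \<open>heat_kernel_mult\<close> only one factor depends on \<open>y\<close>, and it
  is a translated kernel of mass one.\<close>

lemma heat_kernel_semigroup:
  fixes x :: "'a::euclidean_space"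
  assumes "s > 0" "r > 0"
  shows "(\<integral>\<^sup>+y. ennreal (heat_kernel s y * heat_kernel r (x - y)) \<partial>lborel) = heat_kernel (s + r) x"
proof -
  define c where "c = (s / (s + r)) *\<^sub>R x"
  have pos: "s * r / (s + r) > 0"
    using assms by simp
  have sym: "heat_kernel t (y - c) = heat_kernel t (c - y)" for t y
    by (simp add: heat_kernel_def norm_minus_commute)
  have "(\<integral>\<^sup>+y. ennreal (heat_kernel s y * heat_kernel r (x - y)) \<partial>lborel)
      = (\<integral>\<^sup>+y. ennreal (heat_kernel (s + r) x) * ennreal (heat_kernel (s * r / (s + r)) (c - y)) \<partial>lborel)"
    using assms by (simp add: heat_kernel_mult c_def[symmetric] sym ennreal_mult)
  also have "\<dots> = ennreal (heat_kernel (s + r) x) *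
      (\<integral>\<^sup>+y. ennreal (heat_kernel (s * r / (s + r)) (c - y)) \<partial>lborel)"
    by (rule nn_integral_cmult) measurable
  also have "(\<integral>\<^sup>+y. ennreal (heat_kernel (s * r / (s + r)) (c - y)) \<partial>lborel) = 1"
    using nn_integral_lborel_reflect[of "\<lambda>y. ennreal (heat_kernel (s * r / (s + r)) y)" c]
      nn_integral_heat_kernel[OF pos, where 'a='a] by simp
  finally show ?thesis by simp
qed

text \<open>The indicator turns the integral over past times into a convolution on all of
  space-time; the damping makes the kernel integrable there.\<close>

definition damped_kernel :: "real \<Rightarrow> real \<times> 'a::euclidean_space \<Rightarrow> real" where
  "damped_kernel a q = indicator {0..} (fst q) * exp (- a * fst q) * heat_kernel (fst q) (snd q)"

lemma damped_kernel_nonneg [simp]: "0 \<le> damped_kernel a q"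
  by (simp add: damped_kernel_def)

lemma measurable_damped_kernel [measurable]:
  "damped_kernel a \<in> borel_measurable (borel :: (real \<times> 'a::euclidean_space) measure)"
  unfolding damped_kernel_def by (simp add: borel_prod[symmetric])

lemma nn_integral_lborel_Pair:
  fixes f :: "'a::euclidean_space \<times> 'b::euclidean_space \<Rightarrow> ennreal"
  assumes "f \<in> borel_measurable borel"
  shows "(\<integral>\<^sup>+q. f q \<partial>lborel) = (\<integral>\<^sup>+s. \<integral>\<^sup>+y. f (s, y) \<partial>lborel \<partial>lborel)"
proof -
  have "f \<in> borel_measurable (lborel \<Otimes>\<^sub>M lborel)"
    using assms by (simp add: lborel_prod)
  from lborel.nn_integral_fst[OF this] show ?thesis
    by (simp add: lborel_prod)
qed

lemma nn_integral_damped_kernel: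
  assumes "a > 0"
  shows "(\<integral>\<^sup>+q. damped_kernel a (q :: real \<times> 'a::euclidean_space) \<partial>lborel) = ennreal (1 / a)"
proof -
  have "(\<integral>\<^sup>+q. damped_kernel a (q :: real \<times> 'a) \<partial>lborel)
      = (\<integral>\<^sup>+r. \<integral>\<^sup>+y. ennreal (damped_kernel a (r, y :: 'a)) \<partial>lborel \<partial>lborel)"
    by (rule nn_integral_lborel_Pair) measurable
  also have "\<dots> = (\<integral>\<^sup>+r. ennreal (exp (- a * r)) * indicator {0..} r \<partial>lborel)"
  proof (rule nn_integral_cong_AE)
    \<comment> \<open>The kernel has mass one only for positive times; the slice at time 0 is a null
      set.\<close>
    have "AE r in lborel. r \<noteq> (0::real)"
      by (rule AE_lborel_singleton)
    then show "AE r in lborel. (\<integral>\<^sup>+y. ennreal (damped_kernel a (r, y :: 'a)) \<partial>lborel)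
        = ennreal (exp (- a * r)) * indicator {0..} r"
    proof eventually_elim
      case (elim r)
      show ?case
      proof (cases "r > 0")
        case True
        then have "(\<integral>\<^sup>+y. ennreal (damped_kernel a (r, y :: 'a)) \<partial>lborel)
            = (\<integral>\<^sup>+y. ennreal (exp (- a * r)) * ennreal (heat_kernel r (y :: 'a)) \<partial>lborel)"
          by (simp add: damped_kernel_def ennreal_mult)
        also have "\<dots> = ennreal (exp (- a * r)) * (\<integral>\<^sup>+y. ennreal (heat_kernel r (y :: 'a)) \<partial>lborel)"
          by (rule nn_integral_cmult) measurable
        finally show ?thesis
          using True by (simp add: nn_integral_heat_kernel)
      next
        case False
        then show ?thesis using elim by (simp add: damped_kernel_def)
      qed
    qed
  qed
  also have "\<dots> = ennreal (0 - (- exp (- a * 0) / a))"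
  proof (rule nn_integral_FTC_atLeast)
    show "((\<lambda>r. - exp (- a * r) / a) has_real_derivative exp (- a * r)) (at r)" for r
      using assms by (auto intro!: derivative_eq_intros)
    have "filterlim (\<lambda>r. a * r) at_top at_top"
      using assms by (intro filterlim_tendsto_pos_mult_at_top[OF tendsto_const]) (auto simp: filterlim_ident)
    then have "((\<lambda>r. exp (- a * r)) \<longlongrightarrow> 0) at_top"
      by (intro filterlim_compose[OF exp_at_bot]) (simp add: filterlim_uminus_at_bot)
    from tendsto_divide[OF tendsto_minus[OF this] tendsto_const[of a]] assms
    show "((\<lambda>r. - exp (- a * r) / a) \<longlongrightarrow> 0) at_top" by simp
  qed auto
  finally show ?thesis by simp
qed

lemma integrable_damped_kernel:
  "a > 0 \<Longrightarrow> integrable lborel (damped_kernel a :: real \<times> 'a::euclidean_space \<Rightarrow> real)"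
  by (rule integrableI_nonneg) (auto simp: nn_integral_damped_kernel)

lemma integral_damped_kernel:
  assumes "a > 0"
  shows "(\<integral>q. damped_kernel a (q :: real \<times> 'a::euclidean_space) \<partial>lborel) = 1 / a"
  using assms by (subst integral_eq_nn_integral) (auto simp: nn_integral_damped_kernel)

text \<open>This is the resolvent identity for kernels. By the semigroup property the space integral
  does not depend on the intermediate time \<open>r\<close>, and what remains is the integral of
  \<open>exp (- a * r - b * (R - r))\<close> over \<open>{0..R}\<close>.\<close>

lemma nn_integral_damped_kernel_conv:
  fixes m :: "real \<times> 'a::euclidean_space"
  assumes "a < b"
  shows "(\<integral>\<^sup>+q. ennreal (damped_kernel a q * damped_kernel b (m - q)) \<partial>lborel)
       = ennreal ((damped_kernel a m - damped_kernel b m) / (b - a))"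
proof -
  obtain R Y where m: "m = (R, Y)" by (cases m)
  have "(\<integral>\<^sup>+q. ennreal (damped_kernel a q * damped_kernel b (m - q)) \<partial>lborel)
      = (\<integral>\<^sup>+r. \<integral>\<^sup>+y. ennreal (damped_kernel a (r, y) * damped_kernel b (m - (r, y))) \<partial>lborel \<partial>lborel)"
    by (rule nn_integral_lborel_Pair) measurable
  also have "\<dots> = (\<integral>\<^sup>+r. ennreal (heat_kernel R Y) *
      (ennreal (exp (- a * r - b * (R - r))) * indicator {0..R} r) \<partial>lborel)"
  proof (rule nn_integral_cong_AE)
    \<comment> \<open>The semigroup property needs both \<open>r\<close> and \<open>R - r\<close>
      positive; outside \<open>{0..R}\<close> one of the two indicators vanishes.\<close>
    have "AE r in lborel. r \<noteq> (0::real)" "AE r in lborel. r \<noteq> R"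
      by (rule AE_lborel_singleton)+
    then show "AE r in lborel.
        (\<integral>\<^sup>+y. ennreal (damped_kernel a (r, y) * damped_kernel b (m - (r, y))) \<partial>lborel)
        = ennreal (heat_kernel R Y) * (ennreal (exp (- a * r - b * (R - r))) * indicator {0..R} r)"
    proof eventually_elim
      case (elim r)
      show ?case
      proof (cases "0 < r \<and> r < R")
        case True
        have "(\<integral>\<^sup>+y. ennreal (damped_kernel a (r, y) * damped_kernel b (m - (r, y))) \<partial>lborel)
            = (\<integral>\<^sup>+y. ennreal (exp (- a * r - b * (R - r))) *
                ennreal (heat_kernel r y * heat_kernel (R - r) (Y - y)) \<partial>lborel)"
          using True by (intro nn_integral_cong)
            (simp add: damped_kernel_def m ennreal_mult[symmetric] exp_add[symmetric] exp_diff exp_minus field_simps)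
        also have "\<dots> = ennreal (exp (- a * r - b * (R - r))) *
            (\<integral>\<^sup>+y. ennreal (heat_kernel r y * heat_kernel (R - r) (Y - y)) \<partial>lborel)"
          by (rule nn_integral_cmult) measurable
        also have "\<dots> = ennreal (exp (- a * r - b * (R - r))) * ennreal (heat_kernel R Y)"
          using True by (simp add: heat_kernel_semigroup)
        finally show ?thesis
          using True by (simp add: mult.commute)
      next
        case False
        then show ?thesis using elim by (auto simp: damped_kernel_def m indicator_def)
      qed
    qed
  qed
  also have "\<dots> = ennreal (heat_kernel R Y) *
      (\<integral>\<^sup>+r. ennreal (exp (- a * r - b * (R - r))) * indicator {0..R} r \<partial>lborel)"
    by (rule nn_integral_cmult) measurable
  also have "\<dots> = ennreal ((damped_kernel a m - damped_kernel b m) / (b - a))"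
  proof (cases "R \<ge> 0")
    case True
    have "(\<integral>\<^sup>+r. ennreal (exp (- a * r - b * (R - r))) * indicator {0..R} r \<partial>lborel)
        = ennreal (exp (- a * R - b * (R - R)) / (b - a) - exp (- a * 0 - b * (R - 0)) / (b - a))"
    proof (rule nn_integral_FTC_Icc)
      show "((\<lambda>r. exp (- a * r - b * (R - r)) / (b - a)) has_real_derivative exp (- a * r - b * (R - r))) (at r)" for r
        using assms by (auto intro!: derivative_eq_intros simp: add.commute)
    qed (use True in auto)
    also have "\<dots> = ennreal ((exp (- a * R) - exp (- b * R)) / (b - a))"
      by (simp add: diff_divide_distrib)
    finally show ?thesis
      using assms True
      by (simp add: damped_kernel_def m ennreal_mult'[symmetric] algebra_simps)
  next
    case False
    then show ?thesis by (simp add: damped_kernel_def m)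
  qed
  finally show ?thesis .
qed

section \<open>Resolvents of the heat operator\<close>

lemma
  fixes p :: "'a::euclidean_space" and f :: "'a \<Rightarrow> real"
  assumes [measurable]: "f \<in> borel_measurable borel"
  shows integral_lborel_translate: "(\<integral>q. f (q - p) \<partial>lborel) = (\<integral>q. f q \<partial>lborel)"
    and integrable_lborel_translate: "integrable lborel (\<lambda>q. f (q - p)) \<longleftrightarrow> integrable lborel f"
proof -
  show "(\<integral>q. f (q - p) \<partial>lborel) = (\<integral>q. f q \<partial>lborel)"
    using integral_lborel_reflect[of "\<lambda>q. f (- q)" p] integral_lborel_reflect[of f 0] by simp
  show "integrable lborel (\<lambda>q. f (q - p)) \<longleftrightarrow> integrable lborel f"
    using integrable_lborel_reflect[of "\<lambda>q. f (- q)" p] integrable_lborel_reflect[of f 0] by simp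
qed

section \<open>Convolution of integrable kernels with bounded functions\<close>

lemma integrable_mult_bounded:
  fixes K g :: "'a \<Rightarrow> real"
  assumes "integrable M K" and "g \<in> borel_measurable M" and "\<And>x. \<bar>g x\<bar> \<le> B"
  shows "integrable M (\<lambda>x. K x * g x)"
proof (rule Bochner_Integration.integrable_bound)
  show "integrable M (\<lambda>x. B * K x)"
    using assms(1) by simp
  show "AE x in M. norm (K x * g x) \<le> norm (B * K x)"
  proof (rule AE_I2)
    fix x
    have "\<bar>g x\<bar> \<le> \<bar>B\<bar>"
      using assms(3)[of x] by linarith
    then show "norm (K x * g x) \<le> norm (B * K x)"
      by (simp add: abs_mult mult.commute[of "\<bar>B\<bar>"] mult_left_mono)
  qed
qed (use assms in measurable)

text \<open>Substitute \<open>m = q + r\<close> in the inner integral and exchange the order of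
  integration.\<close>

lemma convolution_assoc:
  fixes K L g :: "'a::euclidean_space \<Rightarrow> real"
  assumes K: "integrable lborel K" and L: "integrable lborel L"
    and [measurable]: "g \<in> borel_measurable borel" and B: "\<And>x. \<bar>g x\<bar> \<le> B"
  shows "(\<integral>q. K q * (\<integral>r. L r * g (p - q - r) \<partial>lborel) \<partial>lborel)
       = (\<integral>m. (\<integral>q. K q * L (m - q) \<partial>lborel) * g (p - m) \<partial>lborel)"
proof -
  have [measurable]: "K \<in> borel_measurable borel" "L \<in> borel_measurable borel"
    using borel_measurable_integrable[OF K] borel_measurable_integrable[OF L] by auto
  have Lq: "integrable lborel (\<lambda>m. L (m - q))" for q
    using L by (simp add: integrable_lborel_translate)
  define F where "F = (\<lambda>q m. K q * L (m - q) * g (p - m))"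
  have Fint: "integrable lborel (F q)" for q
    unfolding F_def by (intro integrable_mult_bounded integrable_mult_right Lq) (use B in auto)
  have "integrable (lborel \<Otimes>\<^sub>M lborel) (case_prod F)"
  proof (rule lborel_pair.Fubini_integrable)
    show "case_prod F \<in> borel_measurable (lborel \<Otimes>\<^sub>M lborel)"
      unfolding F_def by measurable
    then have [measurable]: "case_prod F \<in> borel_measurable (borel \<Otimes>\<^sub>M borel)"
      by simp
    \<comment> \<open>Fubini applies because the inner integral of \<open>\<bar>F q m\<bar>\<close>
      is at most \<open>B * \<bar>K q\<bar>\<close> times the L1 norm of \<open>L\<close>.\<close>
    show "integrable lborel (\<lambda>q. \<integral>m. norm (case (q, m) of (q, m) \<Rightarrow> F q m) \<partial>lborel)"
    proof (rule Bochner_Integration.integrable_bound)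
      show "integrable lborel (\<lambda>q. B * (\<integral>r. \<bar>L r\<bar> \<partial>lborel) * K q)"
        using K by simp
      show "AE q in lborel. norm (\<integral>m. norm (case (q, m) of (q, m) \<Rightarrow> F q m) \<partial>lborel)
          \<le> norm (B * (\<integral>r. \<bar>L r\<bar> \<partial>lborel) * K q)"
      proof (rule AE_I2)
        fix q
        have "(\<integral>m. \<bar>F q m\<bar> \<partial>lborel) \<le> (\<integral>m. B * \<bar>K q\<bar> * \<bar>L (m - q)\<bar> \<partial>lborel)"
        proof (rule integral_mono)
          show "integrable lborel (\<lambda>m. \<bar>F q m\<bar>)"
            using Fint by simp
          show "integrable lborel (\<lambda>m. B * \<bar>K q\<bar> * \<bar>L (m - q)\<bar>)"
            using Lq[of q] by simp
          show "\<bar>F q m\<bar> \<le> B * \<bar>K q\<bar> * \<bar>L (m - q)\<bar>" for m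
            using mult_left_mono[OF B[of "p - m"], of "\<bar>K q\<bar> * \<bar>L (m - q)\<bar>"]
            by (simp add: F_def abs_mult mult_ac)
        qed
        also have "\<dots> = B * \<bar>K q\<bar> * (\<integral>r. \<bar>L r\<bar> \<partial>lborel)"
          using integral_lborel_translate[of "\<lambda>r. \<bar>L r\<bar>" q] by simp
        also have "\<dots> \<le> \<bar>B * (\<integral>r. \<bar>L r\<bar> \<partial>lborel) * K q\<bar>"
          by (simp add: abs_mult mult_right_mono mult_ac mult_left_mono)
        finally show "norm (\<integral>m. norm (case (q, m) of (q, m) \<Rightarrow> F q m) \<partial>lborel)
          \<le> norm (B * (\<integral>r. \<bar>L r\<bar> \<partial>lborel) * K q)"
          by simp
      qed
    qed measurable
  qed (use Fint in auto)
  then have "(\<integral>m. (\<integral>q. F q m \<partial>lborel) \<partial>lborel) = (\<integral>q. (\<integral>m. F q m \<partial>lborel) \<partial>lborel)"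
    by (rule lborel_pair.Fubini_integral)
  moreover have "(\<integral>m. F q m \<partial>lborel) = K q * (\<integral>r. L r * g (p - q - r) \<partial>lborel)" for q
    using integral_lborel_translate[of "\<lambda>r. L r * g (p - q - r)" q]
    by (simp add: F_def mult.assoc)
  moreover have "(\<integral>q. F q m \<partial>lborel) = (\<integral>q. K q * L (m - q) \<partial>lborel) * g (p - m)" for m
    by (simp add: F_def)
  ultimately show ?thesis by simp
qed

text \<open>Sources are kept as bounded continuous functions on all of space-time, which form a
  Banach space. Cutting them off at negative times restricts the convolution at time
  \<open>t\<close> to \<open>{0..t}\<close>; the possible jump at time 0 is smoothed by the
  integration.\<close>

definition time_cut :: "((real \<times> 'a::euclidean_space) \<Rightarrow>\<^sub>C real) \<Rightarrow> real \<times> 'a \<Rightarrow> real" where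
  "time_cut h q = indicator {0..} (fst q) * h q"

lemma measurable_time_cut [measurable]: "time_cut h \<in> borel_measurable borel"
proof -
  have "apply_bcontfun h \<in> borel_measurable borel"
    by (rule borel_measurable_continuous_onI) simp
  moreover have "(\<lambda>q. indicator {0..} (fst q) :: real) \<in> borel_measurable (borel :: (real \<times> 'a) measure)"
    by (simp add: borel_prod[symmetric])
  ultimately show ?thesis
    unfolding time_cut_def by measurable
qed

lemma abs_time_cut_le: "\<bar>time_cut h q\<bar> \<le> norm h"
  using norm_bounded[of h q] by (auto simp: time_cut_def indicator_def)

lemma integrable_damped_conv:
  "a > 0 \<Longrightarrow> integrable lborel (\<lambda>q. damped_kernel a q * time_cut h (p - q))"
  by (intro integrable_mult_bounded[of _ _ _ "norm h"] integrable_damped_kernel)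
    (auto simp: abs_time_cut_le)

lemma abs_damped_conv_le:
  fixes h :: "(real \<times> 'a::euclidean_space) \<Rightarrow>\<^sub>C real"
  assumes "a > 0"
  shows "\<bar>\<integral>q. damped_kernel a q * time_cut h (p - q) \<partial>lborel\<bar> \<le> norm h / a"
proof -
  have "\<bar>\<integral>q. damped_kernel a q * time_cut h (p - q) \<partial>lborel\<bar>
      \<le> (\<integral>q. \<bar>damped_kernel a q * time_cut h (p - q)\<bar> \<partial>lborel)"
    using integral_norm_bound[of lborel "\<lambda>q. damped_kernel a q * time_cut h (p - q)"] by simp
  also have "\<dots> \<le> (\<integral>q. damped_kernel a (q :: real \<times> 'a) * norm h \<partial>lborel)"
  proof (rule integral_mono)
    show "integrable lborel (\<lambda>q. \<bar>damped_kernel a q * time_cut h (p - q)\<bar>)"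
      using integrable_damped_conv[OF assms] by (rule integrable_abs)
    show "\<bar>damped_kernel a q * time_cut h (p - q)\<bar> \<le> damped_kernel a q * norm h" for q
      by (simp add: abs_mult mult_left_mono abs_time_cut_le)
  qed (intro integrable_mult_left integrable_damped_kernel assms)
  also have "\<dots> = norm h / a"
    using assms by (simp add: integral_damped_kernel)
  finally show ?thesis .
qed

text \<open>Time slices are null sets, so the jump of \<open>time_cut\<close> does not affect limits
  under the integral.\<close>

lemma AE_lborel_fst_neq: "AE q :: real \<times> 'a::euclidean_space in lborel. fst q \<noteq> t"
proof (rule AE_I')
  have "emeasure (lborel \<Otimes>\<^sub>M lborel) ({t} \<times> (UNIV :: 'a set)) = 0"
    by (subst lborel.emeasure_pair_measure_Times) auto
  then show "{t} \<times> (UNIV :: 'a set) \<in> null_sets lborel"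
    by (auto simp: lborel_prod null_sets_def closed_Times intro!: borel_closed)
qed auto

text \<open>Continuity follows by dominated convergence with majorant
  \<open>damped_kernel a q * norm h\<close>. The integrand converges whenever \<open>p - q\<close>
  is off time 0, since the sign of the time of \<open>u n - q\<close> is then eventually
  constant.\<close>

lemma damped_conv_bcontfun:
  fixes h :: "(real \<times> 'a::euclidean_space) \<Rightarrow>\<^sub>C real"
  assumes "a > 0"
  shows "(\<lambda>p. \<integral>q. damped_kernel a q * time_cut h (p - q) \<partial>lborel) \<in> bcontfun"
proof (rule bcontfun_normI)
  show "norm (\<integral>q. damped_kernel a q * time_cut h (p - q) \<partial>lborel) \<le> norm h / a" for p
    using abs_damped_conv_le[OF assms] by simp
  show "continuous_on UNIV (\<lambda>p. \<integral>q. damped_kernel a q * time_cut h (p - q) \<partial>lborel)"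
  proof (rule continuous_on_sequentiallyI)
    fix u :: "nat \<Rightarrow> real \<times> 'a" and p
    assume u: "u \<longlonglongrightarrow> p"
    show "(\<lambda>n. \<integral>q. damped_kernel a q * time_cut h (u n - q) \<partial>lborel)
        \<longlonglongrightarrow> (\<integral>q. damped_kernel a q * time_cut h (p - q) \<partial>lborel)"
    proof (rule integral_dominated_convergence)
      show "integrable lborel (\<lambda>q. damped_kernel a (q :: real \<times> 'a) * norm h)"
        by (intro integrable_mult_left integrable_damped_kernel assms)
      show "AE q in lborel. norm (damped_kernel a q * time_cut h (u n - q)) \<le> damped_kernel a q * norm h" for n
      by (simp add: abs_mult mult_left_mono abs_time_cut_le)
      show "AE q in lborel. (\<lambda>n. damped_kernel a q * time_cut h (u n - q))
          \<longlonglongrightarrow> damped_kernel a q * time_cut h (p - q)"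
        using AE_lborel_fst_neq[of "fst p"]
      proof eventually_elim
        case (elim q)
        have lim: "(\<lambda>n. u n - q) \<longlonglongrightarrow> p - q"
          by (intro tendsto_intros u)
        then have fst_lim: "(\<lambda>n. fst (u n - q)) \<longlonglongrightarrow> fst (p - q)"
          by (rule tendsto_fst)
        have h_lim: "(\<lambda>n. h (u n - q)) \<longlonglongrightarrow> h (p - q)"
          by (rule continuous_on_tendsto_compose[of UNIV, OF _ lim]) auto
        have "(\<lambda>n. time_cut h (u n - q)) \<longlonglongrightarrow> time_cut h (p - q)"
        proof (cases "fst (p - q) > 0")
          case True
          have "eventually (\<lambda>n. time_cut h (u n - q) = h (u n - q)) sequentially"
            using order_tendstoD(1)[OF fst_lim True] by eventually_elim (simp add: time_cut_def)
          moreover have "time_cut h (p - q) = h (p - q)"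
            using True by (simp add: time_cut_def)
          ultimately show ?thesis
            using h_lim by (simp add: tendsto_cong)
        next
          case False
          then have neg: "fst (p - q) < 0"
            using elim by simp
          have "eventually (\<lambda>n. time_cut h (u n - q) = 0) sequentially"
            using order_tendstoD(2)[OF fst_lim neg] by eventually_elim (simp add: time_cut_def)
          moreover have "time_cut h (p - q) = 0"
            using neg by (simp add: time_cut_def)
          ultimately show ?thesis
            by (simp add: tendsto_eventually)
        qed
        then show ?case
          by (intro tendsto_intros)
      qed
    qed measurable
  qed
qed

text \<open>Formally this inverts the operator "time derivative minus half the Laplacian plus
  \<open>a\<close>" with zero initial data. The wrapper \<open>Bcontfun\<close> is justified for
  \<open>a > 0\<close> by \<open>damped_conv_bcontfun\<close>.\<close>

definition heat_resolvent ::
  "real \<Rightarrow> ((real \<times> 'a::euclidean_space) \<Rightarrow>\<^sub>C real) \<Rightarrow> ((real \<times> 'a) \<Rightarrow>\<^sub>C real)" where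
  "heat_resolvent a h = Bcontfun (\<lambda>p. \<integral>q. damped_kernel a q * time_cut h (p - q) \<partial>lborel)"

lemma heat_resolvent_apply:
  "a > 0 \<Longrightarrow> heat_resolvent a h p = (\<integral>q. damped_kernel a q * time_cut h (p - q) \<partial>lborel)"
  by (simp add: heat_resolvent_def Bcontfun_inverse damped_conv_bcontfun)

lemma norm_heat_resolvent_le: "a > 0 \<Longrightarrow> norm (heat_resolvent a h) \<le> norm h / a"
  by (intro norm_bound) (simp add: heat_resolvent_apply abs_damped_conv_le)

lemma time_cut_linear:
  "time_cut (g + h) q = time_cut g q + time_cut h q"
  "time_cut (c *\<^sub>R h) q = c * time_cut h q"
  by (auto simp: time_cut_def algebra_simps)

lemma bounded_linear_heat_resolvent:
  assumes "a > 0"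
  shows "bounded_linear (heat_resolvent a :: ((real \<times> 'a::euclidean_space) \<Rightarrow>\<^sub>C real) \<Rightarrow> _)"
proof (rule bounded_linear_intro)
  show "norm (heat_resolvent a h) \<le> norm h * (1 / a)" for h :: "(real \<times> 'a) \<Rightarrow>\<^sub>C real"
    using norm_heat_resolvent_le[OF assms] by simp
  show "heat_resolvent a (g + h) = heat_resolvent a g + heat_resolvent a h"
    for g h :: "(real \<times> 'a) \<Rightarrow>\<^sub>C real"
    by (intro bcontfun_eqI)
      (simp add: heat_resolvent_apply assms time_cut_linear distrib_left integrable_damped_conv)
  show "heat_resolvent a (c *\<^sub>R h) = c *\<^sub>R heat_resolvent a h" for c and h :: "(real \<times> 'a) \<Rightarrow>\<^sub>C real"
    by (intro bcontfun_eqI) (simp add: heat_resolvent_apply assms time_cut_linear mult.left_commute)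
qed

text \<open>Kernel and cut source both live on nonnegative times, hence so does their convolution.
  Iterated resolvents are therefore plain double convolutions.\<close>

lemma time_cut_heat_resolvent:
  assumes "a > 0"
  shows "time_cut (heat_resolvent a h) p = heat_resolvent a h p"
proof (cases "fst p \<ge> 0")
  case False
  then have "damped_kernel a q * time_cut h (p - q) = 0" for q
    by (auto simp: damped_kernel_def time_cut_def indicator_def)
  then have "heat_resolvent a h p = 0"
    by (simp only: heat_resolvent_apply[OF assms] integral_zero)
  then show ?thesis
    by (simp add: time_cut_def)
qed (simp add: time_cut_def)

lemma damped_kernel_conv:
  fixes m :: "real \<times> 'a::euclidean_space"
  assumes "a \<noteq> b"
  shows "(\<integral>q. damped_kernel a q * damped_kernel b (m - q) \<partial>lborel)
       = (damped_kernel a m - damped_kernel b m) / (b - a)"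
proof -
  have less: "(\<integral>q. damped_kernel a q * damped_kernel b (m - q) \<partial>lborel)
       = (damped_kernel a m - damped_kernel b m) / (b - a)" if "a < b" for a b
  proof -
    \<comment> \<open>The difference of the kernels is nonnegative, so nothing is lost in passing
      from \<open>ennreal\<close> to the reals.\<close>
    have "exp (- b * fst m) \<le> exp (- a * fst m)" if "fst m \<ge> 0"
      using that \<open>a < b\<close> by (simp add: mult_right_mono)
    then have le: "damped_kernel b m \<le> damped_kernel a m"
      unfolding damped_kernel_def by (intro mult_right_mono) (auto simp: indicator_def)
    have "(\<integral>q. damped_kernel a q * damped_kernel b (m - q) \<partial>lborel)
        = enn2real (\<integral>\<^sup>+q. ennreal (damped_kernel a q * damped_kernel b (m - q)) \<partial>lborel)"
      by (rule integral_eq_nn_integral) auto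
    then show ?thesis
      using that le by (simp only: nn_integral_damped_kernel_conv) simp
  qed
  show ?thesis
  proof (cases "a < b")
    case False
    \<comment> \<open>Convolution is commutative, by the reflection of \<open>q\<close> to
      \<open>m - q\<close>; this swaps \<open>a\<close> and \<open>b\<close>.\<close>
    have "(\<integral>q. damped_kernel a q * damped_kernel b (m - q) \<partial>lborel)
        = (\<integral>q. damped_kernel b q * damped_kernel a (m - q) \<partial>lborel)"
      using integral_lborel_reflect[of "\<lambda>q. damped_kernel a q * damped_kernel b (m - q)" m]
      by (simp add: mult.commute)
    also have "\<dots> = (damped_kernel b m - damped_kernel a m) / (a - b)"
      using False assms by (intro less) simp
    finally show ?thesis
      using assms by (simp add: field_simps)
  qed (rule less)
qed

text \<open>Associativity gathers the two kernels into their convolution, which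
  \<open>damped_kernel_conv\<close> evaluates.\<close>

lemma resolvent_identity:
  assumes "a > 0" "b > 0"
  shows "heat_resolvent a h - heat_resolvent b h = (b - a) *\<^sub>R heat_resolvent a (heat_resolvent b h)"
proof (cases "a = b")
  case False
  have "heat_resolvent a h p - heat_resolvent b h p = (b - a) * heat_resolvent a (heat_resolvent b h) p" for p
  proof -
    have "heat_resolvent a (heat_resolvent b h) p
        = (\<integral>q. damped_kernel a q * (\<integral>r. damped_kernel b r * time_cut h (p - q - r) \<partial>lborel) \<partial>lborel)"
      using assms by (simp add: heat_resolvent_apply time_cut_heat_resolvent)
    also have "\<dots> = (\<integral>m. (\<integral>q. damped_kernel a q * damped_kernel b (m - q) \<partial>lborel) * time_cut h (p - m) \<partial>lborel)"
      using assms by (intro convolution_assoc[where B = "norm h"])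
        (auto simp: integrable_damped_kernel abs_time_cut_le)
    also have "\<dots> = (\<integral>m. (damped_kernel a m * time_cut h (p - m) - damped_kernel b m * time_cut h (p - m)) / (b - a) \<partial>lborel)"
      using False by (simp add: damped_kernel_conv left_diff_distrib)
    also have "\<dots> = (heat_resolvent a h p - heat_resolvent b h p) / (b - a)"
      using assms by (simp add: integrable_damped_conv heat_resolvent_apply)
    finally show ?thesis
      using False by simp
  qed
  then show ?thesis
    by (intro bcontfun_eqI) simp
qed simp

text \<open>Formally \<open>l *\<^sub>R w\<close> is added to both sides of the differential
  equation for \<open>w\<close>. The resolvent identity replaces this manipulation, as no derivative
  of \<open>w\<close> is available.\<close>

lemma heat_resolvent_shift:
  assumes "a > 0" "l \<ge> 0"
  shows "w = heat_resolvent a h \<longleftrightarrow> w = heat_resolvent (l + a) (h + l *\<^sub>R w)"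
proof
  interpret A: bounded_linear "heat_resolvent a :: ((real \<times> 'a) \<Rightarrow>\<^sub>C real) \<Rightarrow> _"
    using assms by (intro bounded_linear_heat_resolvent)
  interpret B: bounded_linear "heat_resolvent (l + a) :: ((real \<times> 'a) \<Rightarrow>\<^sub>C real) \<Rightarrow> _"
    using assms by (intro bounded_linear_heat_resolvent) simp
  {
    assume "w = heat_resolvent a h"
    then have "heat_resolvent (l + a) h - w = - (l *\<^sub>R heat_resolvent (l + a) w)"
      using resolvent_identity[of "l + a" a h] assms by simp
    moreover have "w = heat_resolvent (l + a) h - (heat_resolvent (l + a) h - w)"
      by simp
    ultimately show "w = heat_resolvent (l + a) (h + l *\<^sub>R w)"
      by (simp only: B.add B.scaleR diff_minus_eq_add)
  next
    assume w: "w = heat_resolvent (l + a) (h + l *\<^sub>R w)"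
    \<comment> \<open>The resolvent identity is applied to \<open>h + l *\<^sub>R w\<close>, whose
      resolvent at \<open>l + a\<close> is \<open>w\<close> itself; the terms
      \<open>l *\<^sub>R heat_resolvent a w\<close> cancel.\<close>
    then show "w = heat_resolvent a h"
      using resolvent_identity[of a "l + a" "h + l *\<^sub>R w"] assms
      by (simp add: A.add A.scaleR w[symmetric])
  }
qed

text \<open>After the shift, \<open>N = norm (v - w)\<close> satisfies
  \<open>(l + \<kappa> + 1) * N \<le> (\<kappa> + l) * N + \<epsilon>\<close>. The damping exceeds
  the Lipschitz constant by exactly 1, so \<open>l\<close> drops out of the conclusion.\<close>

lemma heat_resolvent_stability:
  assumes "\<kappa> \<ge> 0" "l \<ge> 0"
    and v: "v = heat_resolvent (\<kappa> + 1) g" and w: "w = heat_resolvent (\<kappa> + 1) h"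
    and le: "norm (g - h + l *\<^sub>R (v - w)) \<le> (\<kappa> + l) * norm (v - w) + \<epsilon>"
  shows "norm (v - w) \<le> \<epsilon>"
proof -
  interpret A: bounded_linear "heat_resolvent (\<kappa> + 1) :: ((real \<times> 'a) \<Rightarrow>\<^sub>C real) \<Rightarrow> _"
    using assms by (intro bounded_linear_heat_resolvent) simp
  have pos: "\<kappa> + 1 > 0"
    using assms(1) by simp
  have "v - w = heat_resolvent (\<kappa> + 1) (g - h)"
    using v w by (simp add: A.diff)
  then have "v - w = heat_resolvent (l + (\<kappa> + 1)) (g - h + l *\<^sub>R (v - w))"
    by (rule iffD1[OF heat_resolvent_shift[OF pos assms(2)]])
  then have "norm (v - w) \<le> norm (g - h + l *\<^sub>R (v - w)) / (l + (\<kappa> + 1))"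
    using norm_heat_resolvent_le[of "l + (\<kappa> + 1)" "g - h + l *\<^sub>R (v - w)"] assms(1,2) by simp
  also have "\<dots> \<le> ((\<kappa> + l) * norm (v - w) + \<epsilon>) / (l + (\<kappa> + 1))"
    using le assms(1,2) by (simp add: divide_right_mono)
  finally show ?thesis
    using assms(1,2) by (simp add: field_simps)
qed

text \<open>Banach's theorem for the shifted equation, with contraction factor
  \<open>(\<kappa> + l) / (l + (\<kappa> + 1))\<close>; the shift is then undone.\<close>

lemma heat_resolvent_fixed_point:
  fixes H :: "((real \<times> 'a::euclidean_space) \<Rightarrow>\<^sub>C real) \<Rightarrow> ((real \<times> 'a) \<Rightarrow>\<^sub>C real)"
  assumes "\<kappa> \<ge> 0" "l \<ge> 0"
    and le: "\<And>v w. norm (H v - H w + l *\<^sub>R (v - w)) \<le> (\<kappa> + l) * norm (v - w)"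
  shows "\<exists>w. w = heat_resolvent (\<kappa> + 1) (H w)"
proof -
  interpret B: bounded_linear "heat_resolvent (l + (\<kappa> + 1)) :: ((real \<times> 'a) \<Rightarrow>\<^sub>C real) \<Rightarrow> _"
    using assms by (intro bounded_linear_heat_resolvent) simp
  define \<Phi> where "\<Phi> w = heat_resolvent (l + (\<kappa> + 1)) (H w + l *\<^sub>R w)" for w
  have "dist (\<Phi> v) (\<Phi> w) \<le> (\<kappa> + l) / (l + (\<kappa> + 1)) * dist v w" for v w
  proof -
    have "\<Phi> v - \<Phi> w = heat_resolvent (l + (\<kappa> + 1)) (H v - H w + l *\<^sub>R (v - w))"
      by (simp add: \<Phi>_def B.add B.diff B.scaleR scaleR_diff_right)
    then have "dist (\<Phi> v) (\<Phi> w) \<le> norm (H v - H w + l *\<^sub>R (v - w)) / (l + (\<kappa> + 1))"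
      using norm_heat_resolvent_le[of "l + (\<kappa> + 1)" "H v - H w + l *\<^sub>R (v - w)"] assms(1,2)
      by (simp add: dist_norm)
    also have "\<dots> \<le> ((\<kappa> + l) * norm (v - w)) / (l + (\<kappa> + 1))"
      using le assms(1,2) by (intro divide_right_mono) auto
    finally show ?thesis
      by (simp add: dist_norm)
  qed
  then have "\<exists>!w. \<Phi> w = w"
    using assms(1,2) by (intro banach_fix_type[of "(\<kappa> + l) / (l + (\<kappa> + 1))"]) auto
  then obtain w where "w = heat_resolvent (l + (\<kappa> + 1)) (H w + l *\<^sub>R w)"
    unfolding \<Phi>_def by metis
  then show ?thesis
    using heat_resolvent_shift[of "\<kappa> + 1" l w "H w"] assms(1,2) by auto
qed

section \<open>One-sided Lipschitz nonlinearities\<close>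

text \<open>For \<open>\<sigma> (t, x) = \<mu> t\<close> and \<open>w = exp (- \<sigma>) (u - Z)\<close>, this is \<open>exp (- \<sigma>) F(u)\<close>: the equation for
  \<open>u\<close> becomes \<open>w = heat_resolvent \<mu> (nonlin \<sigma> Z F w)\<close>.\<close>

definition nonlin :: "('p::topological_space \<Rightarrow>\<^sub>C real) \<Rightarrow> ('p \<Rightarrow>\<^sub>C real) \<Rightarrow> (real \<Rightarrow>\<^sub>C real)
    \<Rightarrow> ('p \<Rightarrow>\<^sub>C real) \<Rightarrow> ('p \<Rightarrow>\<^sub>C real)" where
  "nonlin \<sigma> Z F w = Bcontfun (\<lambda>p. exp (- \<sigma> p) * F (exp (\<sigma> p) * w p + Z p))"

lemma abs_exp_mult_le: "s \<ge> 0 \<Longrightarrow> \<bar>exp (- s) * c\<bar> \<le> \<bar>c\<bar>" for s c :: real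
  by (simp add: abs_mult mult_left_le_one_le)

lemma nonlin_apply:
  fixes \<sigma> Z :: "'p::topological_space \<Rightarrow>\<^sub>C real" and F :: "real \<Rightarrow>\<^sub>C real"
  assumes "\<And>p. 0 \<le> \<sigma> p"
  shows "nonlin \<sigma> Z F w p = exp (- \<sigma> p) * F (exp (\<sigma> p) * w p + Z p)"
proof -
  have "(\<lambda>p. exp (- \<sigma> p) * F (exp (\<sigma> p) * w p + Z p)) \<in> bcontfun"
  proof (rule bcontfun_normI)
    have "continuous_on UNIV (\<lambda>p. F (exp (\<sigma> p) * w p + Z p))"
      by (rule continuous_on_compose2[of UNIV "apply_bcontfun F"]) (auto intro!: continuous_intros)
    then show "continuous_on UNIV (\<lambda>p. exp (- \<sigma> p) * F (exp (\<sigma> p) * w p + Z p))"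
      by (intro continuous_intros) auto
    show "norm (exp (- \<sigma> p) * F (exp (\<sigma> p) * w p + Z p)) \<le> norm F" for p
      using abs_exp_mult_le[OF assms[of p], of "F (exp (\<sigma> p) * w p + Z p)"]
        norm_bounded[of F "exp (\<sigma> p) * w p + Z p"] by simp
  qed
  then show ?thesis
    by (simp add: nonlin_def Bcontfun_inverse)
qed

text \<open>The shift makes the nonlinearity monotone, so that its increments lie between \<open>0\<close> and
  \<open>\<kappa> + l\<close> times those of the argument.\<close>

lemma abs_one_sided_shift_le:
  fixes F :: "real \<Rightarrow> real"
  assumes osl: "\<And>x y. x < y \<Longrightarrow> F y - F x \<le> \<kappa> * (y - x)"
    and lip: "\<And>x y. x < y \<Longrightarrow> \<bar>F y - F x\<bar> \<le> l * (y - x)"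
  shows "\<bar>F x - F y + l * (x - y)\<bar> \<le> (\<kappa> + l) * \<bar>x - y\<bar>"
proof -
  have *: "\<bar>F y - F x + l * (y - x)\<bar> \<le> (\<kappa> + l) * (y - x)" if "x < y" for x y
    using osl[OF that] lip[OF that] by (simp add: abs_le_iff algebra_simps)
  consider "x < y" | "x = y" | "y < x" by linarith
  then show ?thesis
  proof cases
    case 1
    have "F x - F y + l * (x - y) = - (F y - F x + l * (y - x))"
      by (simp add: algebra_simps)
    then show ?thesis
      using *[OF 1] 1 by (simp only: abs_minus_cancel) simp
  qed (use * in auto)
qed

text \<open>The weight \<open>exp (\<sigma> p)\<close> inside \<open>F\<close> and
  \<open>exp (- \<sigma> p)\<close> outside cancel on increments, so the constants of
  \<open>F\<close> carry over unchanged.\<close>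

lemma nonlin_shift_le:
  fixes \<sigma> Z :: "'p::topological_space \<Rightarrow>\<^sub>C real" and F :: "real \<Rightarrow>\<^sub>C real"
  assumes \<sigma>: "\<And>p. 0 \<le> \<sigma> p"
    and osl: "\<And>x y. x < y \<Longrightarrow> F y - F x \<le> \<kappa> * (y - x)"
    and lip: "\<And>x y. x < y \<Longrightarrow> \<bar>F y - F x\<bar> \<le> l * (y - x)"
  shows "\<bar>nonlin \<sigma> Z F v p - nonlin \<sigma> Z F w p + l * (v p - w p)\<bar> \<le> (\<kappa> + l) * \<bar>v p - w p\<bar>"
proof -
  define x where "x = exp (\<sigma> p) * v p + Z p"
  define y where "y = exp (\<sigma> p) * w p + Z p"
  have diff: "v p - w p = exp (- \<sigma> p) * (x - y)"
    by (simp add: x_def y_def exp_minus field_simps)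
  have "nonlin \<sigma> Z F v p - nonlin \<sigma> Z F w p + l * (v p - w p)
      = exp (- \<sigma> p) * (F x - F y + l * (x - y))"
    unfolding diff by (simp add: nonlin_apply[OF \<sigma>] x_def y_def algebra_simps)
  moreover have "exp (- \<sigma> p) * \<bar>F x - F y + l * (x - y)\<bar> \<le> exp (- \<sigma> p) * ((\<kappa> + l) * \<bar>x - y\<bar>)"
    by (intro mult_left_mono abs_one_sided_shift_le osl lip) auto
  ultimately show ?thesis
    unfolding diff by (simp add: abs_mult mult_ac)
qed

text \<open>Here \<open>\<epsilon>\<close> measures the defect at \<open>w\<close> only. Taking for
  \<open>h\<close> another nonlinearity at \<open>w\<close> compares two solutions; taking
  \<open>w = 0\<close> and \<open>h = 0\<close> bounds a single one.\<close>

lemma nonlin_equation_stability: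
  fixes \<sigma> Z :: "(real \<times> 'a::euclidean_space) \<Rightarrow>\<^sub>C real" and F :: "real \<Rightarrow>\<^sub>C real"
  assumes "\<kappa> \<ge> 0" "l \<ge> 0"
    and \<sigma>: "\<And>p. 0 \<le> \<sigma> p"
    and osl: "\<And>x y. x < y \<Longrightarrow> F y - F x \<le> \<kappa> * (y - x)"
    and lip: "\<And>x y. x < y \<Longrightarrow> \<bar>F y - F x\<bar> \<le> l * (y - x)"
    and v: "v = heat_resolvent (\<kappa> + 1) (nonlin \<sigma> Z F v)"
    and w: "w = heat_resolvent (\<kappa> + 1) h"
    and \<epsilon>: "\<And>p. \<bar>nonlin \<sigma> Z F w p - h p\<bar> \<le> \<epsilon>"
  shows "norm (v - w) \<le> \<epsilon>"
proof (rule heat_resolvent_stability[OF assms(1,2) v w], rule norm_bound)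
  fix p
  have "\<bar>nonlin \<sigma> Z F v p - h p + l * (v p - w p)\<bar>
      \<le> \<bar>nonlin \<sigma> Z F v p - nonlin \<sigma> Z F w p + l * (v p - w p)\<bar> + \<bar>nonlin \<sigma> Z F w p - h p\<bar>"
    by linarith
  also have "\<dots> \<le> (\<kappa> + l) * \<bar>v p - w p\<bar> + \<epsilon>"
    by (intro add_mono nonlin_shift_le \<sigma> osl lip \<epsilon>)
  also have "\<dots> \<le> (\<kappa> + l) * norm (v - w) + \<epsilon>"
    using norm_bounded[of "v - w" p] assms(1,2) by (simp add: mult_left_mono)
  finally show "norm ((nonlin \<sigma> Z F v - h + l *\<^sub>R (v - w)) p) \<le> (\<kappa> + l) * norm (v - w) + \<epsilon>"
    by simp
qed

text \<open>The approximants are the averages of \<open>F\<close> over \<open>[x, x + h]\<close>.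
  Their derivative is a difference quotient of \<open>F\<close>, hence at most
  \<open>\<kappa>\<close> and in absolute value at most \<open>2 * norm F / h\<close>.\<close>

lemma lipschitz_approximation:
  fixes F :: "real \<Rightarrow>\<^sub>C real"
  assumes uc: "uniformly_continuous_on UNIV F"
    and osl: "\<And>x y. x < y \<Longrightarrow> F y - F x \<le> \<kappa> * (y - x)"
    and "e > 0"
  shows "\<exists>G :: real \<Rightarrow>\<^sub>C real. \<exists>l\<ge>0. (\<forall>x y. x < y \<longrightarrow> apply_bcontfun G y - apply_bcontfun G x \<le> \<kappa> * (y - x)) \<and>
    (\<forall>x y. x < y \<longrightarrow> \<bar>apply_bcontfun G y - apply_bcontfun G x\<bar> \<le> l * (y - x)) \<and> dist G F \<le> e"
proof -
  \<comment> \<open>An antiderivative on the whole line expresses the averages without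
    integrals.\<close>
  have "\<exists>P. \<forall>x. - \<infinity> < ereal x \<longrightarrow> ereal x < \<infinity> \<longrightarrow> (P has_vector_derivative F x) (at x)"
    by (rule einterval_antiderivative)
      (auto simp: continuous_on_eq_continuous_at[OF open_UNIV, symmetric] intro: continuous_on_interior[of UNIV])
  then obtain P where P: "(P has_real_derivative F x) (at x)" for x
    by (auto simp: has_real_derivative_iff_has_vector_derivative)
  obtain h where "h > 0" and h: "\<And>x y. \<bar>y - x\<bar> < h \<Longrightarrow> \<bar>F y - F x\<bar> < e"
    using uc \<open>e > 0\<close> unfolding uniformly_continuous_on_def dist_real_def by (metis UNIV_I)
  define g where "g x = (P (x + h) - P x) / h" for x
  \<comment> \<open>An average is a value of \<open>F\<close> at distance less than
    \<open>h\<close>; this gives both the sup bound and the closeness to \<open>F\<close>.\<close>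
  have mean: "\<exists>y. \<bar>y - x\<bar> < h \<and> g x = F y" for x
  proof -
    obtain y where "x < y" "y < x + h" "P (x + h) - P x = (x + h - x) * F y"
      using MVT2[of x "x + h" P "apply_bcontfun F"] P \<open>h > 0\<close> by auto
    then show ?thesis
      using \<open>h > 0\<close> by (intro exI[of _ y]) (auto simp: g_def)
  qed
  have deriv: "(g has_real_derivative (F (x + h) - F x) / h) (at x)" for x
  proof -
    have "((\<lambda>x. P (x + h)) has_real_derivative F (x + h)) (at x)"
      using P DERIV_shift by blast
    then show ?thesis
      unfolding g_def using \<open>h > 0\<close> by (auto intro!: derivative_eq_intros P)
  qed
  have mvt: "\<exists>z. g y - g x = (y - x) * ((F (z + h) - F z) / h)" if "x < y" for x y
    using MVT2[of x y g "\<lambda>x. (F (x + h) - F x) / h"] deriv that by auto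
  have "g \<in> bcontfun"
  proof (rule bcontfun_normI)
    show "continuous_on UNIV g"
      using deriv by (intro DERIV_continuous_on) (auto intro: has_field_derivative_at_within)
    show "norm (g x) \<le> norm F" for x
      using mean[of x] norm_bounded[of F] by auto
  qed
  then have ap: "apply_bcontfun (Bcontfun g) = g"
    by (rule Bcontfun_inverse)
  show ?thesis
  proof (intro exI[of _ "Bcontfun g"] exI[of _ "2 * norm F / h"] conjI allI impI)
    show "0 \<le> 2 * norm F / h"
      using \<open>h > 0\<close> by simp
    show "Bcontfun g y - Bcontfun g x \<le> \<kappa> * (y - x)" if xy: "x < y" for x y
    proof -
      obtain z where z: "g y - g x = (y - x) * ((F (z + h) - F z) / h)"
        using mvt[OF xy] by auto
      have "(F (z + h) - F z) / h \<le> \<kappa>"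
        using osl[of z "z + h"] \<open>h > 0\<close> by (simp add: field_simps)
      then show ?thesis
        using mult_left_mono[of "(F (z + h) - F z) / h" \<kappa> "y - x"] xy
        by (simp add: ap z mult.commute[of \<kappa>])
    qed
    show "\<bar>Bcontfun g y - Bcontfun g x\<bar> \<le> 2 * norm F / h * (y - x)" if xy: "x < y" for x y
    proof -
      obtain z where z: "g y - g x = (y - x) * ((F (z + h) - F z) / h)"
        using mvt[OF xy] by auto
      have "\<bar>F (z + h) - F z\<bar> \<le> 2 * norm F"
        using norm_bounded[of F "z + h"] norm_bounded[of F z] by auto
      then have "\<bar>(F (z + h) - F z) / h\<bar> \<le> 2 * norm F / h"
        using \<open>h > 0\<close> by (simp add: divide_right_mono)
      then show ?thesis
        using mult_left_mono[of "\<bar>(F (z + h) - F z) / h\<bar>" "2 * norm F / h" "y - x"] xy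
        by (simp add: ap z abs_mult mult.commute[of _ "y - x"])
    qed
    show "dist (Bcontfun g) F \<le> e"
    proof (rule dist_bound)
      fix x
      obtain y where "\<bar>y - x\<bar> < h" "g x = F y"
        using mean by blast
      then show "dist (Bcontfun g x) (F x) \<le> e"
        using h[of y x] by (simp add: ap dist_real_def)
    qed
  qed
qed

text \<open>Uniform continuity of \<open>F\<close> is what makes composition with \<open>F\<close>
  continuous in the sup norm.\<close>

lemma nonlin_tendsto:
  fixes \<sigma> Z :: "'p::topological_space \<Rightarrow>\<^sub>C real" and F :: "real \<Rightarrow>\<^sub>C real"
  assumes \<sigma>: "\<And>p. 0 \<le> \<sigma> p"
    and uc: "uniformly_continuous_on UNIV F"
    and G: "G \<longlonglongrightarrow> F" and w: "w \<longlonglongrightarrow> v"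
  shows "(\<lambda>n. nonlin \<sigma> Z (G n) (w n)) \<longlonglongrightarrow> nonlin \<sigma> Z F v"
proof (rule tendstoI)
  fix e :: real assume "e > 0"
  then obtain d where "d > 0" and d: "\<And>x y. dist y x < d \<Longrightarrow> dist (F y) (F x) < e / 3"
    using uc unfolding uniformly_continuous_on_def by (metis UNIV_I divide_pos_pos zero_less_numeral)
  have "eventually (\<lambda>n. dist (G n) F < e / 3) sequentially"
    using tendstoD[OF G, of "e / 3"] \<open>e > 0\<close> by simp
  \<comment> \<open>The arguments of \<open>F\<close> differ by the distance of the weighted
    functions, amplified by at most \<open>exp (norm \<sigma>)\<close>.\<close>
  moreover have "eventually (\<lambda>n. dist (w n) v < d / exp (norm \<sigma>)) sequentially"
    using tendstoD[OF w, of "d / exp (norm \<sigma>)"] \<open>d > 0\<close> by simp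
  ultimately show "eventually (\<lambda>n. dist (nonlin \<sigma> Z (G n) (w n)) (nonlin \<sigma> Z F v) < e) sequentially"
  proof eventually_elim
    case (elim n)
    \<comment> \<open>Passing to the supremum only preserves a weak inequality, so a bound below
      \<open>e\<close> is aimed at.\<close>
    have "dist (nonlin \<sigma> Z (G n) (w n)) (nonlin \<sigma> Z F v) \<le> 2 * e / 3"
    proof (rule dist_bound)
      fix p
      define x where "x = exp (\<sigma> p) * v p + Z p"
      define y where "y = exp (\<sigma> p) * w n p + Z p"
      have "dist y x = exp (\<sigma> p) * dist (w n p) (v p)"
        by (simp add: x_def y_def dist_real_def right_diff_distrib[symmetric] abs_mult)
      also have "\<dots> \<le> exp (norm \<sigma>) * dist (w n) v"
        using norm_bounded[of \<sigma> p] by (intro mult_mono) (auto intro: dist_bounded)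
      also have "\<dots> < d"
        using elim(2) by (simp add: field_simps)
      finally have "\<bar>F y - F x\<bar> < e / 3"
        using d by (simp add: dist_real_def)
      moreover have "\<bar>G n y - F y\<bar> < e / 3"
        using dist_fun_lt_imp_dist_val_lt[OF elim(1)] by (simp add: dist_real_def)
      moreover have "dist (nonlin \<sigma> Z (G n) (w n) p) (nonlin \<sigma> Z F v p) \<le> \<bar>G n y - F x\<bar>"
        using abs_exp_mult_le[OF \<sigma>[of p], of "G n y - F x"]
        by (simp add: dist_real_def nonlin_apply[OF \<sigma>] x_def y_def right_diff_distrib)
      ultimately show "dist (nonlin \<sigma> Z (G n) (w n) p) (nonlin \<sigma> Z F v p) \<le> 2 * e / 3"
        by linarith
    qed
    then show ?case
      using \<open>e > 0\<close> by simp
  qed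
qed

text \<open>The bound \<open>B\<close> concerns \<open>F\<close> on the range of \<open>Z\<close>
  only, not \<open>norm F\<close>. This lets a truncation level be chosen from \<open>B\<close>
  without circularity.\<close>

lemma nonlin_equation_solvable:
  fixes Z \<sigma> :: "(real \<times> 'a::euclidean_space) \<Rightarrow>\<^sub>C real" and F :: "real \<Rightarrow>\<^sub>C real"
  assumes "\<kappa> \<ge> 0" and \<sigma>: "\<And>p. 0 \<le> \<sigma> p"
    and uc: "uniformly_continuous_on UNIV F"
    and osl: "\<And>x y. x < y \<Longrightarrow> F y - F x \<le> \<kappa> * (y - x)"
    and B: "\<And>p. \<bar>F (Z p)\<bar> \<le> B"
  shows "\<exists>w. w = heat_resolvent (\<kappa> + 1) (nonlin \<sigma> Z F w) \<and> norm w \<le> B"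
proof -
  interpret A: bounded_linear "heat_resolvent (\<kappa> + 1) :: ((real \<times> 'a) \<Rightarrow>\<^sub>C real) \<Rightarrow> _"
    using assms by (intro bounded_linear_heat_resolvent) simp
  define Q where "Q n G l \<longleftrightarrow> l \<ge> 0 \<and> (\<forall>x y. x < y \<longrightarrow> G y - G x \<le> \<kappa> * (y - x)) \<and>
    (\<forall>x y. x < y \<longrightarrow> \<bar>G y - G x\<bar> \<le> l * (y - x)) \<and> dist G F \<le> inverse (real (Suc n))"
    for n l and G :: "real \<Rightarrow>\<^sub>C real"
  have "\<exists>G l. Q n G l" for n
    using lipschitz_approximation[OF uc osl, of "inverse (real (Suc n))"] unfolding Q_def by auto
  then obtain G l where "\<And>n. Q n (G n) (l n)"
    by metis
  then have l: "l n \<ge> 0"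
    and Gosl: "x < y \<Longrightarrow> G n y - G n x \<le> \<kappa> * (y - x)"
    and Glip: "x < y \<Longrightarrow> \<bar>G n y - G n x\<bar> \<le> l n * (y - x)"
    and GF: "dist (G n) F \<le> inverse (real (Suc n))" for n x y
    unfolding Q_def by blast+
  have G: "G \<longlonglongrightarrow> F"
    unfolding tendsto_dist_iff[of G]
  proof (rule Lim_null_comparison[OF _ LIMSEQ_inverse_real_of_nat])
    show "eventually (\<lambda>n. norm (dist (G n) F) \<le> inverse (real (Suc n))) sequentially"
      using GF by (intro always_eventually) simp
  qed
  have "\<exists>w. w = heat_resolvent (\<kappa> + 1) (nonlin \<sigma> Z (G n) w)" for n
  proof (rule heat_resolvent_fixed_point[OF \<open>\<kappa> \<ge> 0\<close> l[of n]], rule norm_bound)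
    fix v w and p :: "real \<times> 'a"
    have "\<bar>nonlin \<sigma> Z (G n) v p - nonlin \<sigma> Z (G n) w p + l n * (v p - w p)\<bar> \<le> (\<kappa> + l n) * \<bar>v p - w p\<bar>"
      by (intro nonlin_shift_le \<sigma> Gosl Glip)
    also have "\<dots> \<le> (\<kappa> + l n) * norm (v - w)"
      using norm_bounded[of "v - w" p] \<open>\<kappa> \<ge> 0\<close> l[of n] by (simp add: mult_left_mono)
    finally show "norm ((nonlin \<sigma> Z (G n) v - nonlin \<sigma> Z (G n) w + l n *\<^sub>R (v - w)) p) \<le> (\<kappa> + l n) * norm (v - w)"
      by simp
  qed
  then obtain w where w: "\<And>n. w n = heat_resolvent (\<kappa> + 1) (nonlin \<sigma> Z (G n) (w n))"
    by metis
  \<comment> \<open>The Lipschitz constants \<open>l n\<close> may blow up, but the stability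
    estimate does not involve them.\<close>
  have stable: "dist (w m) (w n) \<le> dist (G m) (G n)" for m n
    unfolding dist_norm
  proof (rule nonlin_equation_stability[OF \<open>\<kappa> \<ge> 0\<close> l[of m] \<sigma> Gosl Glip w w])
    fix p
    define x where "x = exp (\<sigma> p) * w n p + Z p"
    have "\<bar>nonlin \<sigma> Z (G m) (w n) p - nonlin \<sigma> Z (G n) (w n) p\<bar> \<le> \<bar>G m x - G n x\<bar>"
      using abs_exp_mult_le[OF \<sigma>[of p], of "G m x - G n x"]
      by (simp add: nonlin_apply[OF \<sigma>] x_def right_diff_distrib)
    then show "\<bar>nonlin \<sigma> Z (G m) (w n) p - nonlin \<sigma> Z (G n) (w n) p\<bar> \<le> norm (G m - G n)"
      using norm_bounded[of "G m - G n" x] by simp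
  qed
  have "Cauchy w"
    using LIMSEQ_imp_Cauchy[OF G] stable unfolding Cauchy_def by (meson le_less_trans)
  then obtain v where v: "w \<longlonglongrightarrow> v"
    using Cauchy_convergent convergent_def by blast
  have "(\<lambda>n. heat_resolvent (\<kappa> + 1) (nonlin \<sigma> Z (G n) (w n))) \<longlonglongrightarrow> heat_resolvent (\<kappa> + 1) (nonlin \<sigma> Z F v)"
    by (intro A.tendsto nonlin_tendsto \<sigma> uc G v)
  then have "w \<longlonglongrightarrow> heat_resolvent (\<kappa> + 1) (nonlin \<sigma> Z F v)"
    by (simp only: w[symmetric])
  with v have "v = heat_resolvent (\<kappa> + 1) (nonlin \<sigma> Z F v)"
    by (rule LIMSEQ_unique)
  moreover have "norm v \<le> B"
  proof (rule LIMSEQ_le)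
    show "(\<lambda>n. norm (w n)) \<longlonglongrightarrow> norm v"
      by (intro tendsto_norm v)
    show "(\<lambda>n. B + inverse (real (Suc n))) \<longlonglongrightarrow> B"
      by (rule LIMSEQ_inverse_real_of_nat_add)
    \<comment> \<open>Compare with the zero function, which solves the equation with zero source;
      its defect is the weighted value of \<open>G n\<close> at \<open>Z p\<close>.\<close>
    have "norm (w n - 0) \<le> B + inverse (real (Suc n))" for n
    proof (rule nonlin_equation_stability[OF \<open>\<kappa> \<ge> 0\<close> l[of n] \<sigma> Gosl Glip w])
      show "0 = heat_resolvent (\<kappa> + 1) (0 :: (real \<times> 'a) \<Rightarrow>\<^sub>C real)"
        by (simp add: A.zero)
      fix p
      have "\<bar>nonlin \<sigma> Z (G n) 0 p\<bar> \<le> \<bar>G n (Z p)\<bar>"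
        using abs_exp_mult_le[OF \<sigma>[of p]] by (simp add: nonlin_apply[OF \<sigma>])
      also have "\<dots> \<le> \<bar>F (Z p)\<bar> + dist (G n) F"
        using dist_bounded[of "G n" "Z p" F] by (simp add: dist_real_def)
      also have "\<dots> \<le> B + inverse (real (Suc n))"
        by (intro add_mono B GF)
      finally show "\<bar>nonlin \<sigma> Z (G n) 0 p - (0 :: (real \<times> 'a) \<Rightarrow>\<^sub>C real) p\<bar> \<le> B + inverse (real (Suc n))"
        by simp
    qed
    then show "\<exists>N. \<forall>n\<ge>N. norm (w n) \<le> B + inverse (real (Suc n))"
      by auto
  qed
  ultimately show ?thesis by blast
qed

section \<open>Truncation of the nonlinearity and return to the integral equation\<close>

lemma abs_clamp_diff_le: "\<bar>max a (min b x) - max a (min b y)\<bar> \<le> \<bar>x - y\<bar>" for a b x y :: real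
  by (auto simp: max_def min_def)

text \<open>Clamping is monotone and does not enlarge increments; as
  \<open>\<kappa> \<ge> 0\<close>, a smaller increment only improves the bound.\<close>

lemma one_sided_lipschitz_clamp:
  fixes f :: "real \<Rightarrow> real"
  assumes osl: "\<And>x y. x < y \<Longrightarrow> f y - f x \<le> \<kappa> * (y - x)" and "\<kappa> \<ge> 0" "x < y"
  shows "f (max a (min b y)) - f (max a (min b x)) \<le> \<kappa> * (y - x)"
proof (cases "max a (min b x) = max a (min b y)")
  case False
  have "max a (min b x) \<le> max a (min b y)"
    using \<open>x < y\<close> by (auto simp: max_def min_def)
  with False have "f (max a (min b y)) - f (max a (min b x)) \<le> \<kappa> * (max a (min b y) - max a (min b x))"
    by (intro osl) linarith
  also have "\<dots> \<le> \<kappa> * (y - x)"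
    using abs_clamp_diff_le[of a b y x] assms(2,3) by (intro mult_left_mono) auto
  finally show ?thesis .
qed (use assms in simp)

lemma uniformly_continuous_clamp:
  fixes f :: "real \<Rightarrow> real"
  assumes "continuous_on UNIV f" "a \<le> b"
  shows "uniformly_continuous_on UNIV (\<lambda>x. f (max a (min b x)))"
proof -
  have "uniformly_continuous_on {a..b} f"
    using assms by (intro compact_uniformly_continuous) (auto intro: continuous_on_subset)
  moreover have "max a (min b x) \<in> {a..b}" for x
    using assms(2) by auto
  moreover have "dist (max a (min b y)) (max a (min b x)) \<le> dist y x" for x y
    by (simp add: dist_real_def abs_clamp_diff_le)
  ultimately show ?thesis
    unfolding uniformly_continuous_on_def by (meson le_less_trans)
qed

text \<open>Reflecting the space-time variable turns the convolution into the Duhamel integral. Of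
  \<open>exp (\<mu> * t)\<close> and the damping over the elapsed time \<open>t - s\<close>, the
  factor \<open>exp (\<mu> * s)\<close> remains, which removes the weight in
  \<open>h\<close>.\<close>

lemma heat_resolvent_eq_set_integral:
  fixes h :: "(real \<times> 'a::euclidean_space) \<Rightarrow>\<^sub>C real"
  assumes "\<mu> > 0" and g: "\<And>s y. 0 \<le> s \<Longrightarrow> s \<le> t \<Longrightarrow> exp (\<mu> * s) * h (s, y) = g s y"
  shows "set_integrable lborel ({0..t} \<times> UNIV) (\<lambda>(s, y). heat_kernel (t - s) (x - y) * g s y)"
    and "(\<integral>(s, y) \<in> {0..t} \<times> UNIV. heat_kernel (t - s) (x - y) * g s y \<partial>lborel)
      = exp (\<mu> * t) * heat_resolvent \<mu> h (t, x)"
proof -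
  define k where "k q = damped_kernel \<mu> ((t, x) - q) * time_cut h q" for q
  have [measurable]: "k \<in> borel_measurable borel"
    unfolding k_def by measurable
  have eq: "indicat_real ({0..t} \<times> UNIV) q *\<^sub>R (case q of (s, y) \<Rightarrow> heat_kernel (t - s) (x - y) * g s y)
      = exp (\<mu> * t) * k q" for q
  proof (cases q)
    case (Pair s y)
    show ?thesis
    proof (cases "0 \<le> s \<and> s \<le> t")
      case True
      have "exp (\<mu> * t) * k q = exp (\<mu> * t) * exp (- \<mu> * (t - s)) * (heat_kernel (t - s) (x - y) * h (s, y))"
        using True by (simp add: k_def Pair damped_kernel_def time_cut_def)
      also have "exp (\<mu> * t) * exp (- \<mu> * (t - s)) = exp (\<mu> * s)"
        by (simp add: exp_add[symmetric] algebra_simps)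
      finally show ?thesis
        using True g[of s y, symmetric] by (simp add: Pair mult_ac)
    qed (auto simp: k_def Pair damped_kernel_def time_cut_def indicator_def)
  qed
  have reflect: "k ((t, x) - q) = damped_kernel \<mu> q * time_cut h ((t, x) - q)" for q
    by (simp add: k_def)
  have "integrable lborel (\<lambda>q. k ((t, x) - q))"
    unfolding reflect by (rule integrable_damped_conv[OF assms(1)])
  then have "integrable lborel k"
    by (subst (asm) integrable_lborel_reflect) auto
  then show "set_integrable lborel ({0..t} \<times> UNIV) (\<lambda>(s, y). heat_kernel (t - s) (x - y) * g s y)"
    unfolding set_integrable_def eq by simp
  have "heat_resolvent \<mu> h (t, x) = (\<integral>q. k ((t, x) - q) \<partial>lborel)"
    unfolding reflect by (rule heat_resolvent_apply[OF assms(1)])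
  also have "\<dots> = (\<integral>q. k q \<partial>lborel)"
    by (rule integral_lborel_reflect) measurable
  finally show "(\<integral>(s, y) \<in> {0..t} \<times> UNIV. heat_kernel (t - s) (x - y) * g s y \<partial>lborel)
      = exp (\<mu> * t) * heat_resolvent \<mu> h (t, x)"
    unfolding set_lebesgue_integral_def eq by simp
qed

theorem mainTheorem9:
  fixes f :: "real \<Rightarrow> real" and \<kappa> :: real and T :: real
    and z :: "real \<times> 'a::euclidean_space \<Rightarrow> real"
  assumes f_cont: "continuous_on UNIV f"
    and f_osl: "\<And>u1 u2. u1 < u2 \<Longrightarrow> f u2 - f u1 \<le> \<kappa> * (u2 - u1)"
    and T_pos: "T > 0"
    and z_Cb: "z \<in> Cb T"
  shows "\<exists>u \<in> Cb T. \<forall>t \<in> {0..T}. \<forall>x.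
           set_integrable lborel ({0..t} \<times> UNIV)
             (\<lambda>(s, y). heat_kernel (t - s) (x - y) * f (u (s, y)))
         \<and> u (t, x) = (\<integral>(s, y) \<in> {0..t} \<times> UNIV.
             heat_kernel (t - s) (x - y) * f (u (s, y)) \<partial>lborel) + z (t, x)"
proof -
  \<comment> \<open>Enlarging the constant to a nonnegative one keeps the one-sided bound and makes
    the damping \<open>k + 1\<close> positive.\<close>
  define k where "k = max \<kappa> 0"
  have k: "k \<ge> 0" "\<kappa> \<le> k"
    by (auto simp: k_def)
  have osl: "f y - f x \<le> k * (y - x)" if "x < y" for x y
    using f_osl[OF that] mult_right_mono[OF k(2), of "y - x"] that by linarith
  define \<mu> where "\<mu> = k + 1"
  have "\<mu> > 0"
    using k by (simp add: \<mu>_def)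
  \<comment> \<open>Freezing time outside \<open>{0..T}\<close> extends both \<open>z\<close> and
    the weight exponent \<open>\<mu> * s\<close> to bounded continuous functions on all of
    space-time, unchanged for times in \<open>{0..T}\<close>.\<close>
  define c where "c s = max 0 (min T s)" for s
  have c: "0 \<le> c s" "c s \<le> T" for s
    using T_pos by (auto simp: c_def)
  have c_eq: "c s = s" if "0 \<le> s" "s \<le> T" for s
    using that by (simp add: c_def)
  have c_cont: "continuous_on UNIV (\<lambda>p :: real \<times> 'a. c (fst p))"
    unfolding c_def by (intro continuous_intros)

  have "(\<lambda>p. \<mu> * c (fst p)) \<in> (bcontfun :: (real \<times> 'a \<Rightarrow> real) set)"
    using \<open>\<mu> > 0\<close> c by (intro bcontfun_normI[of _ "\<mu> * T"] continuous_intros c_cont) (simp add: abs_mult)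
  then obtain \<sigma> where "(\<lambda>p :: real \<times> 'a. \<mu> * c (fst p)) = apply_bcontfun \<sigma>"
    by (rule bcontfunE)
  then have \<sigma>: "\<sigma> p = \<mu> * c (fst p)" for p
    by (rule fun_cong[symmetric])
  have \<sigma>_nonneg: "0 \<le> \<sigma> p" and \<sigma>_le: "\<sigma> p \<le> \<mu> * T" for p
    using \<open>\<mu> > 0\<close> c by (auto simp: \<sigma>)

  obtain M where M: "\<And>p. p \<in> {0..T} \<times> UNIV \<Longrightarrow> \<bar>z p\<bar> \<le> M"
    using z_Cb by (auto simp: Cb_def bounded_iff)
  have "(\<lambda>p. z (c (fst p), snd p)) \<in> (bcontfun :: (real \<times> 'a \<Rightarrow> real) set)"
  proof (rule bcontfun_normI)
    show "continuous_on UNIV (\<lambda>p. z (c (fst p), snd p))"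
    proof (rule continuous_on_compose2[of "{0..T} \<times> UNIV" z])
      show "continuous_on ({0..T} \<times> UNIV) z"
        using z_Cb by (simp add: Cb_def)
      show "continuous_on UNIV (\<lambda>p :: real \<times> 'a. (c (fst p), snd p))"
        by (intro continuous_intros c_cont)
    qed (use c in auto)
    show "norm (z (c (fst p), snd p)) \<le> M" for p
      using M c by auto
  qed
  then obtain Z where "(\<lambda>p. z (c (fst p), snd p)) = apply_bcontfun Z"
    by (rule bcontfunE)
  then have Z: "Z p = z (c (fst p), snd p)" for p
    by (rule fun_cong[symmetric])

  \<comment> \<open>\<open>B\<close> is fixed by \<open>f\<close> on the range of \<open>Z\<close>,
    before the truncation level \<open>R\<close> is chosen.\<close>
  have "bounded (f ` {- norm Z..norm Z})"
    by (intro compact_imp_bounded compact_continuous_image continuous_on_subset[OF f_cont]) auto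
  then obtain B where B: "\<And>y. y \<in> {- norm Z..norm Z} \<Longrightarrow> \<bar>f y\<bar> \<le> B"
    unfolding bounded_iff by (metis imageI real_norm_def)
  have "B \<ge> 0"
    using B[of 0] by simp
  \<comment> \<open>This is the a priori bound for \<open>exp (\<sigma> p) * w p + Z p\<close> when
    \<open>norm w \<le> B\<close>, so solutions never reach the truncated region.\<close>
  define R where "R = norm Z + exp (\<mu> * T) * B"
  have R: "norm Z \<le> R" "0 \<le> R"
    using \<open>B \<ge> 0\<close> by (auto simp: R_def)

  have F_uc: "uniformly_continuous_on UNIV (\<lambda>x. f (max (- R) (min R x)))"
    using R by (intro uniformly_continuous_clamp f_cont) simp
  have "bounded (f ` {- R..R})"
    by (intro compact_imp_bounded compact_continuous_image continuous_on_subset[OF f_cont]) auto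
  then obtain BR where "\<And>y. y \<in> {- R..R} \<Longrightarrow> \<bar>f y\<bar> \<le> BR"
    unfolding bounded_iff by (metis imageI real_norm_def)
  then have "(\<lambda>x. f (max (- R) (min R x))) \<in> bcontfun"
    using R by (intro bcontfun_normI[of _ BR] uniformly_continuous_imp_continuous F_uc) auto
  then obtain F where "(\<lambda>x. f (max (- R) (min R x))) = apply_bcontfun F"
    by (rule bcontfunE)
  then have F: "apply_bcontfun F = (\<lambda>x. f (max (- R) (min R x)))"
    by (rule sym)
  have F_eq: "F x = f x" if "\<bar>x\<bar> \<le> R" for x
    using that by (simp add: F min_absorb2 max_absorb2)

  have "\<exists>w. w = heat_resolvent \<mu> (nonlin \<sigma> Z F w) \<and> norm w \<le> B"
    unfolding \<mu>_def
  proof (rule nonlin_equation_solvable[OF k(1) \<sigma>_nonneg])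
    show "uniformly_continuous_on UNIV F"
      using F_uc by (simp add: F)
    show "F y - F x \<le> k * (y - x)" if "x < y" for x y
      unfolding F by (intro one_sided_lipschitz_clamp osl k that)
    show "\<bar>F (Z p)\<bar> \<le> B" for p
    proof -
      have "\<bar>Z p\<bar> \<le> norm Z"
        using norm_bounded[of Z p] by simp
      then have "\<bar>Z p\<bar> \<le> R" "Z p \<in> {- norm Z..norm Z}"
        using R by auto
      then show ?thesis
        by (simp only: F_eq B)
    qed
  qed
  then obtain w where w: "w = heat_resolvent \<mu> (nonlin \<sigma> Z F w)" and "norm w \<le> B"
    by blast

  define u where "u p = exp (\<sigma> p) * w p + Z p" for p
  \<comment> \<open>Hence \<open>F\<close> and \<open>f\<close> agree along \<open>u\<close>, and
    the truncated equation is the original one.\<close>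
  have u_bound: "\<bar>u p\<bar> \<le> R" for p
  proof -
    have "\<bar>exp (\<sigma> p) * w p\<bar> \<le> exp (\<mu> * T) * B"
      using \<sigma>_le[of p] norm_bounded[of w p] \<open>norm w \<le> B\<close> unfolding abs_mult by (intro mult_mono) auto
    then show ?thesis
      using norm_bounded[of Z p] by (simp add: u_def R_def)
  qed
  show ?thesis
  proof (intro bexI[of _ u] ballI allI)
    show "u \<in> Cb T"
      unfolding Cb_def
    proof (intro CollectI conjI)
      show "continuous_on ({0..T} \<times> UNIV) u"
        unfolding u_def by (intro continuous_intros continuous_on_apply_bcontfun)
      show "bounded (u ` ({0..T} \<times> UNIV))"
        using u_bound by (auto simp: bounded_iff)
    qed
    fix t x assume t: "t \<in> {0..T}"
    have "exp (\<mu> * s) * nonlin \<sigma> Z F w (s, y) = f (u (s, y))" if "0 \<le> s" "s \<le> t" for s y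
    proof -
      have "\<sigma> (s, y) = \<mu> * s"
        using that t c_eq[of s] by (simp add: \<sigma>)
      then have "exp (\<mu> * s) * nonlin \<sigma> Z F w (s, y) = F (u (s, y))"
        by (simp add: nonlin_apply[OF \<sigma>_nonneg] u_def exp_minus)
      then show ?thesis
        by (simp add: F_eq u_bound)
    qed
    note duhamel = heat_resolvent_eq_set_integral[OF \<open>\<mu> > 0\<close> this, where x = x]
    have "u (t, x) = exp (\<mu> * t) * heat_resolvent \<mu> (nonlin \<sigma> Z F w) (t, x) + z (t, x)"
      using t c_eq[of t] by (simp add: u_def \<sigma> Z w[symmetric])
    then show "set_integrable lborel ({0..t} \<times> UNIV)
             (\<lambda>(s, y). heat_kernel (t - s) (x - y) * f (u (s, y)))
         \<and> u (t, x) = (\<integral>(s, y) \<in> {0..t} \<times> UNIV.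
             heat_kernel (t - s) (x - y) * f (u (s, y)) \<partial>lborel) + z (t, x)"
      using duhamel by simp
  qed
qed

end
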